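(* Suppose that $\Omega$ is a closed simply connected domain whose boundary $\Gamma$ is a simple, closed, piecewise-smooth curve. Suppose that $M$ is analytic in this domain and that all its eigenvalues $\lambda_1,\dots,\lambda_k$ in $\Omega$ lie in the interior $\operatorname{int}(\Gamma)$ and are simple. Denote the corresponding eigentriplets by $(\lambda_1,v_1,u_1),\dots,(\lambda_k,v_k,u_k)$, with normalization $c^Hv_1=\cdots=c^Hv_k=1$. Let $\sigma\in\Omega\setminus\{\lambda_1,\dots,\lambda_k\}$, $w_\sigma^H=c^HM(\sigma)^{-1}$, and assume $w_\sigma^HM'(\lambda_1)v_1\ne0$. Then the convergence factors $\rho(A_2)$ of QN2 and $\rho(A_3)$ of QN3 for the eigenpair $(\lambda_1,v_1)$ (as defined in the context) are bounded by $$\rho(A_2)=\rho(A_3)\le\|P_1\|\left\|M(\sigma)-M(\lambda_1)+\frac{1}{w_\sigma^HM'(\lambda_1)v_1}M'(\lambda_1)v_1w_\sigma^HM(\lambda_1)\right\|\left(\sum_{i=2}^k\frac{1}{|\sigma-\lambda_i|}\kappa_i+\|R_\Gamma(\sigma)\|\right),$$ where $P_1=I-v_1c^H$, $$\kappa_i:=\frac{\|u_i\|\|v_i\|}{|u_i^HM'(\lambda_i)v_i|},$$ and $R_\Gamma(\sigma)$ is the remainder term in Keldysh's theorem (defined in the context).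
   Context: $M:\Omega\to\mathbb{C}^{n\times n}$ is matrix-valued. An eigentriplet $(\lambda,v,u)$ satisfies $M(\lambda)v=0$, $u^HM(\lambda)=0$, $v\neq0$, $u\ne0$. The vector $c\in\mathbb{C}^n$ is a fixed normalization vector; the superscript $H$ denotes conjugate transpose; $\|\cdot\|$ is the Euclidean vector norm and induced spectral matrix norm; $\rho$ denotes spectral radius. An eigenvalue is simple if it is a zero of $\det M(\cdot)$ of multiplicity one. Keldysh's theorem states that $$M(\sigma)^{-1}=\sum_{i=1}^k\frac{1}{\sigma-\lambda_i}\frac{v_iu_i^H}{u_i^HM'(\lambda_i)v_i}+R_\Gamma(\sigma)\quad\text{for all }\sigma\in\Omega\setminus\{\lambda_1,\dots,\lambda_k\},$$ where $R_\Gamma$ is analytic in $\operatorname{int}(\Gamma)$; this defines $R_\Gamma$. QN2 is the quasi-Newton iteration with shift $\sigma$ $$\begin{bmatrix}M(\sigma)&M'(\mu_j)x_j\\ c^H&0\end{bmatrix}\begin{bmatrix}x_{j+1}-x_j\\ \mu_{j+1}-\mu_j\end{bmatrix}=-\begin{bmatrix}M(\mu_j)x_j\\ c^Hx_j-1\end{bmatrix};$$ its convergence factor at $(\lambda_1,v_1)$ is $\rho(A_2)$, where, with $\alpha=(w_\sigma^HM'(\lambda_1)v_1)^{-1}$ and $q=M(\sigma)^{-1}M'(\lambda_1)v_1$, $$A_2=\begin{bmatrix}(I-\alpha qc^H)M(\sigma)^{-1}[M(\sigma)-M(\lambda_1)]&0\\ \alpha c^HM(\sigma)^{-1}(M(\sigma)-M(\lambda_1))&0\end{bmatrix}$$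 is the derivative of the fixed-point map at the solution. QN3 is equivalent to residual inverse iteration with normalized iterates: given $x_j$ near $v_1$, let $\mu_{j+1}$ be the solution near $\lambda_1$ of $w_\sigma^HM(\mu_{j+1})x_j=0$, compute $\hat x_{j+1}=x_j-M(\sigma)^{-1}M(\mu_{j+1})x_j$ and take $x_{j+1}=\hat x_{j+1}/(c^H\hat x_{j+1})$. Here $A_3$ denotes the derivative at $v_1$ of this map $x_j\mapsto x_{j+1}$, and $\rho(A_3)$ is the convergence factor of QN3. *)

theory Defs
  imports "HOL-Complex_Analysis.Complex_Analysis"
begin

section \<open>Complex matrices\<close>

text \<open>\<open>hdot u x\<close> is \<open>u\<^sup>H x\<close>, \<open>houter v u\<close> is \<open>v u\<^sup>H\<close>, and \<open>hconj A\<close> is \<open>A\<^sup>H\<close>.\<close>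

definition hdot :: "complex ^ 'n \<Rightarrow> complex ^ 'n \<Rightarrow> complex" where
  "hdot u x = (\<Sum>i\<in>UNIV. cnj (u $ i) * x $ i)"

definition houter :: "complex ^ 'm \<Rightarrow> complex ^ 'n \<Rightarrow> complex ^ 'n ^ 'm" where
  "houter v u = (\<chi> i j. v $ i * cnj (u $ j))"

definition hconj :: "complex ^ 'n ^ 'm \<Rightarrow> complex ^ 'm ^ 'n" where
  "hconj A = (\<chi> i j. cnj (A $ j $ i))"

definition spectral_norm :: "complex ^ 'n ^ 'm \<Rightarrow> real" where
  "spectral_norm A = onorm (\<lambda>x. A *v x)"

definition spectral_radius :: "complex ^ 'n ^ 'n \<Rightarrow> real" where
  "spectral_radius A = Max (norm ` {z. \<exists>x. x \<noteq> 0 \<and> A *v x = z *s x})"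

definition block_matrix ::
  "'a ^ 'n ^ 'm \<Rightarrow> 'a ^ 'l ^ 'm \<Rightarrow> 'a ^ 'n ^ 'k \<Rightarrow> 'a ^ 'l ^ 'k \<Rightarrow> 'a ^ ('n + 'l) ^ ('m + 'k)" where
  "block_matrix A B C D = (\<chi> r s. case r of
       Inl i \<Rightarrow> (case s of Inl j \<Rightarrow> A $ i $ j | Inr j \<Rightarrow> B $ i $ j)
     | Inr i \<Rightarrow> (case s of Inl j \<Rightarrow> C $ i $ j | Inr j \<Rightarrow> D $ i $ j))"


section \<open>Nonlinear eigenvalue problems\<close>

definition mat_analytic_on :: "(complex \<Rightarrow> complex ^ 'n ^ 'm) \<Rightarrow> complex set \<Rightarrow> bool" where
  "mat_analytic_on M S \<longleftrightarrow> (\<forall>i j. (\<lambda>z. M z $ i $ j) analytic_on S)"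

definition mat_deriv :: "(complex \<Rightarrow> complex ^ 'n ^ 'm) \<Rightarrow> complex \<Rightarrow> complex ^ 'n ^ 'm" where
  "mat_deriv M z = (\<chi> i j. deriv (\<lambda>s. M s $ i $ j) z)"

definition eigentriplet ::
  "(complex \<Rightarrow> complex ^ 'n ^ 'n) \<Rightarrow> complex \<Rightarrow> complex ^ 'n \<Rightarrow> complex ^ 'n \<Rightarrow> bool" where
  "eigentriplet M l v u \<longleftrightarrow>
     M l *v v = 0 \<and> (\<forall>y. hdot u (M l *v y) = 0) \<and> v \<noteq> 0 \<and> u \<noteq> 0"

definition nep_eigenvalue :: "(complex \<Rightarrow> complex ^ 'n ^ 'n) \<Rightarrow> complex \<Rightarrow> bool" where
  "nep_eigenvalue M l \<longleftrightarrow> (\<exists>v u. eigentriplet M l v u)"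

definition simple_eigenvalue :: "(complex \<Rightarrow> complex ^ 'n ^ 'n) \<Rightarrow> complex \<Rightarrow> bool" where
  "simple_eigenvalue M l \<longleftrightarrow> det (M l) = 0 \<and> zorder (\<lambda>z. det (M z)) l = 1"

text \<open>The eigenvalue condition number \<open>\<kappa>\<close> of an eigentriplet.\<close>

definition eig_cond ::
  "(complex \<Rightarrow> complex ^ 'n ^ 'n) \<Rightarrow> complex \<Rightarrow> complex ^ 'n \<Rightarrow> complex ^ 'n \<Rightarrow> real" where
  "eig_cond M l v u = norm u * norm v / norm (hdot u (mat_deriv M l *v v))"

definition closed_domain :: "complex set \<Rightarrow> bool" where
  "closed_domain S \<longleftrightarrow> (\<exists>D. open D \<and> connected D \<and> D \<noteq> {} \<and> S = closure D)"

text \<open>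
  The Keldysh expansion
  \<open>M(s)\<^sup>-\<^sup>1 = (\<Sum>i=1..k. 1/(s - \<lambda>\<^sub>i) (v\<^sub>i u\<^sub>i\<^sup>H)/(u\<^sub>i\<^sup>H M'(\<lambda>\<^sub>i) v\<^sub>i)) + R(s)\<close>
  determines the remainder \<open>R\<close> off the eigenvalues; the scalar factors are absorbed into the
  left vector of \<open>houter\<close>. By Keldysh's theorem the singularities at the eigenvalues are
  removable, and the analytic remainder takes its limit values there.
\<close>

definition keldysh_remainder ::
  "(complex \<Rightarrow> complex ^ 'n ^ 'n) \<Rightarrow> nat \<Rightarrow> (nat \<Rightarrow> complex) \<Rightarrow> (nat \<Rightarrow> complex ^ 'n)
     \<Rightarrow> (nat \<Rightarrow> complex ^ 'n) \<Rightarrow> complex \<Rightarrow> complex ^ 'n ^ 'n" where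
  "keldysh_remainder M k lam v u s =
     (let R = (\<lambda>z. matrix_inv (M z) -
        (\<Sum>i=1..k. houter ((1 / (z - lam i) * (1 / hdot (u i) (mat_deriv M (lam i) *v v i))) *s v i) (u i)))
      in if s \<in> lam ` {1..k} then Lim (at s) R else R s)"


section \<open>The quasi-Newton methods\<close>

text \<open>\<open>w_sigma\<close> is determined by \<open>w\<^sub>\<sigma>\<^sup>H = c\<^sup>H M(\<sigma>)\<^sup>-\<^sup>1\<close>.\<close>

definition w_sigma :: "(complex \<Rightarrow> complex ^ 'n ^ 'n) \<Rightarrow> complex ^ 'n \<Rightarrow> complex \<Rightarrow> complex ^ 'n" where
  "w_sigma M c \<sigma> = hconj (matrix_inv (M \<sigma>)) *v c"

text \<open>
  The derivative of the fixed-point map of QN2 at \<open>(v, l)\<close>. Its lower left block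
  \<open>\<alpha> c\<^sup>H M(\<sigma>)\<^sup>-\<^sup>1 (M(\<sigma>) - M(l))\<close> is a row, i.e. a matrix with rows indexed by the
  one-element type \<open>1\<close>; \<open>vec \<alpha>\<close> is the one-component vector \<open>\<alpha>\<close>.
\<close>

definition qn2_matrix ::
  "(complex \<Rightarrow> complex ^ 'n ^ 'n) \<Rightarrow> complex ^ 'n \<Rightarrow> complex \<Rightarrow> complex \<Rightarrow> complex ^ 'n
     \<Rightarrow> complex ^ ('n + 1) ^ ('n + 1)" where
  "qn2_matrix M c \<sigma> l v =
     (let \<alpha> = inverse (hdot (w_sigma M c \<sigma>) (mat_deriv M l *v v));
          q = matrix_inv (M \<sigma>) *v (mat_deriv M l *v v)
      in block_matrix
           ((mat 1 - houter (\<alpha> *s q) c) ** matrix_inv (M \<sigma>) ** (M \<sigma> - M l)) 0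
           (houter (vec \<alpha>) c ** matrix_inv (M \<sigma>) ** (M \<sigma> - M l)) 0)"

text \<open>
  The eigenvalue update of QN3: for \<open>x\<close> near \<open>v\<close>, the solution \<open>\<mu>\<close> near \<open>l\<close> of
  \<open>w\<^sub>\<sigma>\<^sup>H M(\<mu>) x = 0\<close>. If \<open>w\<^sub>\<sigma>\<^sup>H M'(l) v \<noteq> 0\<close>, the implicit function theorem gives such a solution
  branch, and any two branches agree near \<open>v\<close>; so the choice is immaterial for the derivative
  at \<open>v\<close>.
\<close>

definition qn3_mu ::
  "(complex \<Rightarrow> complex ^ 'n ^ 'n) \<Rightarrow> complex ^ 'n \<Rightarrow> complex \<Rightarrow> complex \<Rightarrow> complex ^ 'n
     \<Rightarrow> complex ^ 'n \<Rightarrow> complex" where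
  "qn3_mu M c \<sigma> l v = (SOME \<mu>. \<mu> v = l \<and> isCont \<mu> v \<and>
     (\<forall>\<^sub>F x in nhds v. hdot (w_sigma M c \<sigma>) (M (\<mu> x) *v x) = 0))"

definition qn3_step ::
  "(complex \<Rightarrow> complex ^ 'n ^ 'n) \<Rightarrow> complex ^ 'n \<Rightarrow> complex \<Rightarrow> complex \<Rightarrow> complex ^ 'n
     \<Rightarrow> complex ^ 'n \<Rightarrow> complex ^ 'n" where
  "qn3_step M c \<sigma> l v x =
     (let y = x - matrix_inv (M \<sigma>) *v (M (qn3_mu M c \<sigma> l v x) *v x)
      in (1 / hdot c y) *s y)"

definition qn3_matrix ::
  "(complex \<Rightarrow> complex ^ 'n ^ 'n) \<Rightarrow> complex ^ 'n \<Rightarrow> complex \<Rightarrow> complex \<Rightarrow> complex ^ 'n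
     \<Rightarrow> complex ^ 'n ^ 'n" where
  "qn3_matrix M c \<sigma> l v = (THE A. (qn3_step M c \<sigma> l v has_derivative (\<lambda>h. A *v h)) (at v))"

end

theory Submission
  imports Defs
begin

text \<open>
  Write \<open>N = M(\<sigma>)\<^sup>-\<^sup>1\<close>, \<open>l\<close> for the first eigenvalue, \<open>v\<close> for its eigenvector, \<open>p = M'(l) v\<close>,
  \<open>w = w\<^sub>\<sigma>\<close> and \<open>P = I - v c\<^sup>H\<close>.

  The QN3 map is explicit up to the scalar function \<open>\<mu>(x)\<close> defined by \<open>w\<^sup>H M(\<mu>(x)) x = 0\<close>.
  Differentiating this equation at \<open>v\<close>, where \<open>M(l) v = 0\<close>, gives
  \<open>\<mu>'(h) = - w\<^sup>H M(l) h / (w\<^sup>H p)\<close>, and differentiating the normalized residual correction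
  then gives the factorization \<open>A\<^sub>3 = P N B\<close> with \<open>B = M(\<sigma>) - M(l) + p w\<^sup>H M(l) / (w\<^sup>H p)\<close>
  (lemma \<open>qn3_matrix_eq\<close>). The matrix \<open>B\<close> is the one inside the second norm of the bound.
  In the Keldysh expansion of \<open>N\<close> the term of the first eigenvalue has range spanned by \<open>v\<close>, and
  \<open>P v = 0\<close>; hence \<open>P N\<close> only sees the remaining poles and the remainder, whose norms are
  estimated one by one (lemma \<open>projected_inverse_norm_le\<close>). Since \<open>\<rho>(A\<^sub>3) \<le> \<parallel>A\<^sub>3\<parallel>\<close>, this yields
  the inequality.

  For the equality of the spectral radii, the zero block column of \<open>A\<^sub>2\<close> leaves the upper left
  block \<open>A\<^sub>1\<^sub>1\<close> to carry all its eigenvalues. Both \<open>A\<^sub>1\<^sub>1\<close> and \<open>A\<^sub>3\<close> are annihilated by \<open>c\<^sup>H\<close> from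
  the left, and they agree on the kernel of \<open>c\<^sup>H\<close>: they are the same matrix
  \<open>T = I - N M(l) + N p w\<^sup>H M(l) / (w\<^sup>H p)\<close>, from which a multiple of \<open>N p c\<^sup>H\<close> resp. \<open>v c\<^sup>H\<close> is
  subtracted. An eigenvector of a nonzero eigenvalue lies in that kernel, so both matrices have
  the same nonzero eigenvalues, and both are singular
  (lemmas \<open>eigenvalues_eq_of_annihilated\<close> and \<open>spectral_radius_qn2_eq_qn3\<close>).
\<close>

(* Only vectors and matrices are indexed below, so the dollar sign is released from power series. *)
no_notation fps_nth (infixl "$" 75)

section \<open>Hermitian products and the spectral norm\<close>

lemma hdot_add [simp]: "hdot u (x + y) = hdot u x + hdot u y"
  by (simp add: hdot_def distrib_left sum.distrib)

lemma hdot_diff [simp]: "hdot u (x - y) = hdot u x - hdot u y"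
  by (simp add: hdot_def right_diff_distrib sum_subtractf)

lemma hdot_scale [simp]: "hdot u (a *s x) = a * hdot u x"
  by (simp add: hdot_def sum_distrib_left algebra_simps)

lemma hdot_zero [simp]: "hdot u 0 = 0"
  by (simp add: hdot_def)

lemma hdot_Cauchy_Schwarz: "norm (hdot u x) \<le> norm u * norm x"
proof -
  have "norm (hdot u x) \<le> (\<Sum>i\<in>UNIV. norm (u $ i) * norm (x $ i))"
    unfolding hdot_def by (rule order_trans[OF norm_sum]) (simp add: norm_mult)
  also have "\<dots> \<le> norm u * norm x"
    unfolding norm_vec_def using L2_set_mult_ineq[of "\<lambda>i. norm (u $ i)" "\<lambda>i. norm (x $ i)" UNIV]
    by simp
  finally show ?thesis .
qed

lemma hdot_hconj: "hdot (hconj A *v c) x = hdot c (A *v x)"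
proof -
  have "hdot (hconj A *v c) x = (\<Sum>j\<in>UNIV. \<Sum>i\<in>UNIV. cnj (c $ i) * A $ i $ j * x $ j)"
    by (simp add: hdot_def hconj_def matrix_vector_mult_def sum_distrib_left sum_distrib_right mult_ac)
  also have "\<dots> = (\<Sum>i\<in>UNIV. \<Sum>j\<in>UNIV. cnj (c $ i) * A $ i $ j * x $ j)"
    by (rule sum.swap)
  also have "\<dots> = hdot c (A *v x)"
    by (simp add: hdot_def matrix_vector_mult_def sum_distrib_left mult_ac)
  finally show ?thesis .
qed

lemma houter_mult_vec: "houter a b *v x = hdot b x *s a"
  by (simp add: vec_eq_iff houter_def hdot_def matrix_vector_mult_def sum_distrib_right sum_distrib_left mult_ac)

lemma norm_scale_vec: "norm (a *s x) = norm a * norm (x :: complex ^ 'n)"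
  by (simp add: norm_vec_def L2_set_def norm_mult power_mult_distrib real_sqrt_mult flip: sum_distrib_left)

lemma norm_mult_vec_le: "norm (A *v x) \<le> spectral_norm A * norm x"
  unfolding spectral_norm_def by (rule onorm) simp

lemma spectral_norm_le: "(\<And>x. norm (A *v x) \<le> b * norm x) \<Longrightarrow> spectral_norm A \<le> b"
  unfolding spectral_norm_def by (rule onorm_le)

lemma spectral_norm_nonneg: "0 \<le> spectral_norm A"
  unfolding spectral_norm_def by (rule onorm_pos_le) simp

lemma spectral_norm_mult: "spectral_norm (A ** B) \<le> spectral_norm A * spectral_norm B"
  unfolding spectral_norm_def matrix_vector_mult_matrix_matrix_mult_compose
  by (rule onorm_compose) simp_all

lemma spectral_norm_add: "spectral_norm (A + B) \<le> spectral_norm A + spectral_norm B"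
  unfolding spectral_norm_def matrix_vector_mult_add_rdistrib
  by (rule onorm_triangle) simp_all

lemma spectral_norm_sum: "spectral_norm (\<Sum>i\<in>I. f i) \<le> (\<Sum>i\<in>I. spectral_norm (f i))"
proof (induction I rule: infinite_finite_induct)
  case (insert i I)
  then show ?case using spectral_norm_add[of "f i" "sum f I"] by simp
qed (simp_all add: spectral_norm_def onorm_zero)

lemma spectral_norm_houter: "spectral_norm (houter a b) \<le> norm a * norm b"
proof (rule spectral_norm_le)
  fix x
  show "norm (houter a b *v x) \<le> norm a * norm b * norm x"
    using mult_left_mono[OF hdot_Cauchy_Schwarz[of b x], of "norm a"]
    by (simp add: houter_mult_vec norm_scale_vec mult_ac)
qed

section \<open>Eigenvalues and the spectral radius\<close>

lemma kernel_nontrivial_iff: "(\<exists>x. x \<noteq> 0 \<and> A *v x = 0) \<longleftrightarrow> det A = 0" for A :: "complex ^ 'n ^ 'n"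
  using invertible_det_nz[of A] matrix_left_invertible_ker[of A]
  unfolding invertible_def by (metis matrix_left_right_inverse)

lemma mult_mat_vec: "mat z *v x = z *s x" for x :: "complex ^ 'n"
  by (simp add: matrix_vector_mult_def mat_def vec_eq_iff if_distrib if_distribR cong: if_cong)

lemma eigenvalue_norm_le:
  assumes "x \<noteq> 0" "A *v x = z *s x"
  shows "norm z \<le> spectral_norm A"
  using norm_mult_vec_le[of A x] assms by (simp add: norm_scale_vec)

text \<open>
  The spectral radius is a \<open>Max\<close>, which is meaningful only for a finite set. The eigenvalues are
  the zeros of an entire function, and they are confined to a disc; the function cannot vanish
  identically because it is nonzero outside that disc.
\<close>

lemma finite_eigenvalues: "finite {z. \<exists>x. x \<noteq> 0 \<and> A *v x = z *s x}" for A :: "complex ^ 'n ^ 'n"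
proof -
  define f where "f z = det (A - mat z)" for z
  have f0: "f z = 0 \<longleftrightarrow> (\<exists>x. x \<noteq> 0 \<and> A *v x = z *s x)" for z
    by (simp add: f_def flip: kernel_nontrivial_iff)
       (simp add: matrix_vector_mult_diff_rdistrib mult_mat_vec)
  have hol: "f holomorphic_on UNIV"
  proof -
    have "(\<lambda>z. (A - mat z) $ i $ j) holomorphic_on UNIV" for i j
      by (cases "i = j") (auto simp: mat_def intro!: holomorphic_intros)
    then show ?thesis
      unfolding f_def det_def by (intro holomorphic_intros)
  qed
  have le: "norm z \<le> spectral_norm A" if "f z = 0" for z
    using that f0 eigenvalue_norm_le by blast
  show ?thesis
  proof (cases "f constant_on UNIV")
    case False
    then have "finite {z \<in> cball 0 (spectral_norm A). f z = 0}"
      using hol by (intro holomorphic_compact_finite_zeros) auto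
    moreover have "{z. \<exists>x. x \<noteq> 0 \<and> A *v x = z *s x} \<subseteq> {z \<in> cball 0 (spectral_norm A). f z = 0}"
      using le f0 by auto
    ultimately show ?thesis by (rule finite_subset[rotated])
  next
    case True
    then obtain b where b: "\<And>z. f z = b" by (auto simp: constant_on_def)
    have "f (of_real (spectral_norm A + 1)) \<noteq> 0"
      using le[of "of_real (spectral_norm A + 1)"] spectral_norm_nonneg[of A]
      by (auto simp del: of_real_add)
    then have "{z. \<exists>x. x \<noteq> 0 \<and> A *v x = z *s x} = {}"
      using b by (simp flip: f0)
    then show ?thesis by (simp only: finite.emptyI)
  qed
qed

text \<open>
  Singularity of the matrix puts \<open>0\<close> into the spectrum, so that the maximum is taken over a
  nonempty set.
\<close>

lemma spectral_radius_le:
  fixes A :: "complex ^ 'n ^ 'n"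
  assumes "det A = 0"
  shows "spectral_radius A \<le> spectral_norm A"
proof -
  let ?E = "{z. \<exists>x. x \<noteq> 0 \<and> A *v x = z *s x}"
  have "0 \<in> ?E" using assms kernel_nontrivial_iff[of A] by simp
  then show ?thesis
    unfolding spectral_radius_def using finite_eigenvalues[of A]
    using eigenvalue_norm_le[of _ A] by (intro Max.boundedI) blast+
qed

text \<open>
  Determinants of \<open>A\<close> and \<open>A\<^sup>H\<close> are conjugate, so a matrix is singular as soon as it has a left
  null vector. This serves twice: a point where \<open>det M\<close> vanishes has both eigenvectors, and a
  matrix annihilated by \<open>c\<^sup>H\<close> has the eigenvalue \<open>0\<close>.
\<close>

lemma det_zero_iff_left_kernel: "det A = 0 \<longleftrightarrow> (\<exists>u. u \<noteq> 0 \<and> (\<forall>y. hdot u (A *v y) = 0))"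
  for A :: "complex ^ 'n ^ 'n"
proof -
  have conj: "hconj A *v u = 0 \<longleftrightarrow> (\<forall>y. hdot u (A *v y) = 0)" for u
  proof
    assume "\<forall>y. hdot u (A *v y) = 0"
    then have *: "\<And>y. hdot (hconj A *v u) y = 0" by (simp add: hdot_hconj)
    have "cnj ((hconj A *v u) $ i) = 0" for i
      using *[of "axis i 1"] by (simp add: hdot_def axis_def if_distrib cong: if_cong)
    then show "hconj A *v u = 0" by (simp add: vec_eq_iff)
  next
    assume "hconj A *v u = 0"
    then have "hdot (hconj A *v u) y = 0" for y
      by (simp add: hdot_def)
    then show "\<forall>y. hdot u (A *v y) = 0"
      by (simp add: hdot_hconj)
  qed
  have "det (hconj A) = cnj (det A)"
  proof -
    have "det (hconj A) = det (transpose (\<chi> i j. cnj (A $ i $ j)))"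
      by (simp add: hconj_def transpose_def)
    also have "\<dots> = cnj (det A)"
      unfolding det_transpose by (simp add: det_def)
    finally show ?thesis .
  qed
  then show ?thesis using kernel_nontrivial_iff[of "hconj A"] conj by simp
qed

lemma matrix_inv_left_off_eigenvalues:
  assumes "\<not> nep_eigenvalue M s"
  shows "matrix_inv (M s) ** M s = mat 1"
proof -
  have "det (M s) \<noteq> 0"
    using assms kernel_nontrivial_iff[of "M s"] det_zero_iff_left_kernel[of "M s"]
    unfolding nep_eigenvalue_def eigentriplet_def by blast
  then have "invertible (M s)" by (simp add: invertible_det_nz)
  then have "M s ** matrix_inv (M s) = mat 1 \<and> matrix_inv (M s) ** M s = mat 1"
    unfolding matrix_inv_def invertible_def by (rule someI_ex)
  then show ?thesis ..
qed

text \<open>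
  The zero block column contributes only the eigenvalue \<open>0\<close>, which \<open>A\<close> has by assumption.
  An eigenvector \<open>x\<close> of \<open>A\<close> for \<open>z \<noteq> 0\<close> extends by the lower part \<open>z\<^sup>-\<^sup>1 B x\<close>.
\<close>

lemma block_column_eigenvalues:
  fixes A :: "complex ^ 'n ^ 'n" and B :: "complex ^ 'n ^ 'm"
  assumes "det A = 0"
  shows "{z. \<exists>x. x \<noteq> 0 \<and> block_matrix A 0 B 0 *v x = z *s x} = {z. \<exists>x. x \<noteq> 0 \<and> A *v x = z *s x}"
proof -
  have top: "(block_matrix A 0 B 0 *v x) $ Inl i = (A *v (\<chi> j. x $ Inl j)) $ i"
    and bot: "(block_matrix A 0 B 0 *v x) $ Inr r = (B *v (\<chi> j. x $ Inl j)) $ r" for x i r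
    by (simp_all add: block_matrix_def matrix_vector_mult_def UNIV_Plus_UNIV[symmetric] sum.Plus
             del: UNIV_Plus_UNIV)
  show ?thesis
  proof (intro equalityI subsetI; clarsimp)
    fix z x assume x: "x \<noteq> 0" "block_matrix A 0 B 0 *v x = z *s x"
    let ?y = "\<chi> j. x $ Inl j"
    have yz: "A *v ?y = z *s ?y" using x(2) top[of x] by (simp add: vec_eq_iff)
    show "\<exists>x. x \<noteq> 0 \<and> A *v x = z *s x"
    proof (cases "?y = 0")
      case True
      then have "z * x $ Inr r = 0" for r using x(2) bot[of x r] by simp
      moreover have "\<exists>r. x $ Inr r \<noteq> 0"
      proof (rule ccontr)
        assume "\<nexists>r. x $ Inr r \<noteq> 0"
        moreover have "x $ Inl j = 0" for j using True by (simp add: vec_eq_iff)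
        ultimately have "x $ t = 0" for t by (cases t) auto
        then show False using x(1) by (simp add: vec_eq_iff)
      qed
      ultimately have "z = 0" by auto
      then show ?thesis using assms kernel_nontrivial_iff[of A] by simp
    next
      case False
      then show ?thesis using yz by blast
    qed
  next
    fix z x assume x: "x \<noteq> 0" "A *v x = z *s x"
    show "\<exists>x. x \<noteq> 0 \<and> block_matrix A 0 B 0 *v x = z *s x"
    proof (cases "z = 0")
      case True
      define e :: "complex ^ ('n + 'm)" where "e = (\<chi> t. case t of Inl j \<Rightarrow> 0 | Inr r \<Rightarrow> 1)"
      have e: "(\<chi> j. e $ Inl j) = 0" by (simp add: e_def vec_eq_iff)
      have "(block_matrix A 0 B 0 *v e) $ t = 0" for t
        by (cases t) (simp_all add: top bot e)
      then have "block_matrix A 0 B 0 *v e = z *s e" using True by (simp add: vec_eq_iff)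
      moreover have "e $ Inr undefined \<noteq> 0" by (simp add: e_def)
      then have "e \<noteq> 0" by (metis zero_index)
      ultimately show ?thesis by blast
    next
      case False
      define e :: "complex ^ ('n + 'm)" where
        "e = (\<chi> t. case t of Inl j \<Rightarrow> x $ j | Inr r \<Rightarrow> (1/z) * (B *v x) $ r)"
      have e: "(\<chi> j. e $ Inl j) = x" by (simp add: e_def vec_eq_iff)
      have "(block_matrix A 0 B 0 *v e) $ t = z * e $ t" for t
        using False by (cases t) (simp_all add: top bot e x, simp_all add: e_def)
      then have "block_matrix A 0 B 0 *v e = z *s e" by (simp add: vec_eq_iff)
      moreover have "e \<noteq> 0"
      proof
        assume "e = 0"
        then have "(\<chi> j. e $ Inl j) = 0" by (simp add: vec_eq_iff)
        then show False using e x(1) by simp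
      qed
      ultimately show ?thesis by blast
    qed
  qed
qed

text \<open>
  If \<open>c\<^sup>H A = 0\<close> and \<open>A x = z x\<close> with \<open>z \<noteq> 0\<close>, then \<open>z (c\<^sup>H x) = 0\<close>; hence only the restriction of
  \<open>A\<close> to the kernel of \<open>c\<^sup>H\<close> matters for the nonzero eigenvalues. The eigenvalue \<open>0\<close> is common to
  both matrices, for which \<open>c\<close> is a left null vector.
\<close>

lemma eigenvalues_eq_of_annihilated:
  assumes c: "c \<noteq> 0"
    and A: "\<And>x. hdot c (A *v x) = 0" and B: "\<And>x. hdot c (B *v x) = 0"
    and AB: "\<And>x. hdot c x = 0 \<Longrightarrow> A *v x = B *v x"
  shows "{z. \<exists>x. x \<noteq> 0 \<and> A *v x = z *s x} = {z. \<exists>x. x \<noteq> 0 \<and> B *v x = z *s x}"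
proof -
  have "\<exists>x. x \<noteq> 0 \<and> B *v x = z *s x"
    if "x \<noteq> 0" "A *v x = z *s x" "\<And>x. hdot c (A *v x) = 0" "\<And>x. hdot c (B *v x) = 0"
      "\<And>x. hdot c x = 0 \<Longrightarrow> A *v x = B *v x" for A B z x
  proof (cases "z = 0")
    case True
    have "det B = 0" using c that(4) det_zero_iff_left_kernel by blast
    then show ?thesis using True kernel_nontrivial_iff[of B] by simp
  next
    case False
    have "z * hdot c x = 0" using that(3)[of x] that(2) by simp
    then have "B *v x = z *s x" using that(5)[of x] that(2) False by simp
    then show ?thesis using that(1) by blast
  qed
  from this[of _ A _ B, OF _ _ A B AB] this[of _ B _ A, OF _ _ B A AB[symmetric]]
  show ?thesis by blast
qed

section \<open>Zeros depending on a vector parameter\<close>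

text \<open>
  A linear estimate for the distance of a zero of \<open>F(\<cdot>, x) = \<Sum>\<^sub>j a\<^sub>j(\<cdot>) x\<^sub>j\<close> from a simple zero \<open>l\<close>
  of \<open>F(\<cdot>, v)\<close>. Let \<open>t = \<parallel>x - v\<parallel>\<close>. Near \<open>l\<close>, passing from \<open>v\<close> to \<open>x\<close> changes \<open>F\<close> by at most
  \<open>K t\<close>, whereas \<open>|F(\<mu>, v)| \<ge> \<kappa> |\<mu> - l|\<close> because the zero is simple. On the circle of radius
  \<open>3 K t / \<kappa>\<close> about \<open>l\<close> this gives \<open>|F(\<mu>, x)| \<ge> 2 K t\<close>, while \<open>|F(l, x)| \<le> K t\<close> at the centre. If
  \<open>F(\<cdot>, x)\<close> had no zero in the disc, its reciprocal would violate the maximum modulus principle.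
\<close>

lemma nearby_zero:
  fixes a :: "complex \<Rightarrow> complex ^ 'n" and v :: "complex ^ 'n"
  assumes r: "0 < r" and hol: "\<And>j. (\<lambda>\<mu>. a \<mu> $ j) holomorphic_on ball l r"
    and zero: "(\<Sum>j\<in>UNIV. a l $ j * v $ j) = 0"
    and D: "((\<lambda>\<mu>. \<Sum>j\<in>UNIV. a \<mu> $ j * v $ j) has_field_derivative D) (at l)" "D \<noteq> 0"
  obtains C d where "0 < C" "0 < d"
    "\<And>x. norm (x - v) < d \<Longrightarrow> \<exists>\<mu>. norm (\<mu> - l) \<le> C * norm (x - v) \<and> (\<Sum>j\<in>UNIV. a \<mu> $ j * x $ j) = 0"
proof -
  define F where "F \<mu> x = (\<Sum>j\<in>UNIV. a \<mu> $ j * x $ j)" for \<mu> and x :: "complex ^ 'n"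
  obtain h where h: "\<And>\<mu>. F \<mu> v = h \<mu> * (\<mu> - l)" "isCont h l" "h l = D"
    using D(1) zero unfolding CARAT_DERIV F_def by auto
  have "\<forall>\<^sub>F \<mu> in nhds l. norm (h \<mu>) > norm D / 2"
    using h(2,3) D(2) by (intro order_tendstoD(1)[of _ "norm D"] tendsto_norm) (auto simp: isCont_def tendsto_at_iff_tendsto_nhds)
  then obtain s where s: "0 < s" "\<And>\<mu>. dist \<mu> l < s \<Longrightarrow> norm (h \<mu>) > norm D / 2"
    unfolding eventually_nhds_metric by auto
  define \<kappa> where "\<kappa> = norm D / 2"
  \<comment> \<open>halving keeps the closed disc of radius \<open>R\<close> inside both open discs\<close>
  define R where "R = min (r/2) (s/2)"
  have R: "0 < R" "R < r" "R < s" using r s(1) by (auto simp: R_def)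
  have low: "norm (F \<mu> v) \<ge> \<kappa> * norm (\<mu> - l)" if "\<mu> \<in> cball l R" for \<mu>
    using s(2)[of \<mu>] that R unfolding h(1) \<kappa>_def norm_mult
    by (intro mult_right_mono) (auto simp: dist_commute)
  have "continuous_on (cball l R) (\<lambda>\<mu>. \<Sum>j\<in>UNIV. norm (a \<mu> $ j))"
    using R by (intro continuous_intros holomorphic_on_imp_continuous_on holomorphic_on_subset[OF hol]) auto
  then have "compact ((\<lambda>\<mu>. \<Sum>j\<in>UNIV. norm (a \<mu> $ j)) ` cball l R)"
    by (intro compact_continuous_image) auto
  from bounded_pos[THEN iffD1, OF compact_imp_bounded[OF this]]
  obtain K where K: "0 < K" "\<And>\<mu>. \<mu> \<in> cball l R \<Longrightarrow> (\<Sum>j\<in>UNIV. norm (a \<mu> $ j)) \<le> K"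
    by force
  have up: "norm (F \<mu> x - F \<mu> v) \<le> K * norm (x - v)" if "\<mu> \<in> cball l R" for \<mu> x
  proof -
    have "norm (F \<mu> x - F \<mu> v) = norm (\<Sum>j\<in>UNIV. a \<mu> $ j * (x - v) $ j)"
      by (simp add: F_def right_diff_distrib sum_subtractf)
    also have "\<dots> \<le> (\<Sum>j\<in>UNIV. norm (a \<mu> $ j) * norm (x - v))"
      by (intro order_trans[OF norm_sum] sum_mono, unfold norm_mult)
         (intro mult_left_mono Finite_Cartesian_Product.norm_nth_le norm_ge_zero)
    also have "\<dots> \<le> K * norm (x - v)"
      using K(2)[OF that] by (simp add: mult_right_mono flip: sum_distrib_right)
    finally show ?thesis .
  qed
  have \<kappa>: "0 < \<kappa>" using D(2) by (simp add: \<kappa>_def)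
  define C where "C = 3 * K / \<kappa>"
  have C: "0 < C" "\<kappa> * C = 3 * K" using K(1) \<kappa> by (auto simp: C_def)
  show ?thesis
  proof (rule that[of C "R / C"])
    fix x assume x: "norm (x - v) < R / C"
    define t where "t = norm (x - v)"
    have Ct: "C * t < R" using x C(1) by (simp add: t_def field_simps)
    show "\<exists>\<mu>. norm (\<mu> - l) \<le> C * norm (x - v) \<and> (\<Sum>j\<in>UNIV. a \<mu> $ j * x $ j) = 0"
    proof (cases "t = 0")
      \<comment> \<open>the circle degenerates to its centre\<close>
      case True
      then show ?thesis using zero by (intro exI[of _ l]) (auto simp: t_def)
    next
      case False
      then have t: "0 < t" by (simp add: t_def)
      have sub: "cball l (C * t) \<subseteq> cball l R" using Ct by auto
      have "\<exists>\<mu>\<in>cball l (C * t). F \<mu> x = 0"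
      proof (rule ccontr)
        assume "\<not> ?thesis"
        then have nz: "\<And>\<mu>. \<mu> \<in> cball l (C * t) \<Longrightarrow> F \<mu> x \<noteq> 0" by blast
        have holF: "(\<lambda>\<mu>. F \<mu> x) holomorphic_on cball l (C * t)"
          unfolding F_def using Ct R
          by (intro holomorphic_intros holomorphic_on_subset[OF hol]) auto
        have inv: "(\<lambda>\<mu>. inverse (F \<mu> x)) holomorphic_on cball l (C * t)"
          using holF nz by (intro holomorphic_intros) auto
        have "norm (inverse (F l x)) \<le> inverse (2 * K * t)"
        proof (rule maximum_modulus_frontier[where S = "cball l (C * t)" and f = "\<lambda>\<mu>. inverse (F \<mu> x)"])
          show "(\<lambda>\<mu>. inverse (F \<mu> x)) holomorphic_on interior (cball l (C * t))"
            using inv by (rule holomorphic_on_subset) (rule interior_subset)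
          show "continuous_on (closure (cball l (C * t))) (\<lambda>\<mu>. inverse (F \<mu> x))"
            using holomorphic_on_imp_continuous_on[OF inv] by simp
          fix \<mu> assume "\<mu> \<in> frontier (cball l (C * t))"
          then have \<mu>: "norm (\<mu> - l) = C * t"
            using t C(1) by (simp add: dist_norm norm_minus_commute)
          then have \<mu>R: "\<mu> \<in> cball l R" using Ct by (simp add: dist_norm norm_minus_commute)
          have "2 * K * t = \<kappa> * norm (\<mu> - l) - K * t" using C(2) by (simp add: \<mu> flip: mult.assoc)
          also have "\<dots> \<le> norm (F \<mu> v) - norm (F \<mu> x - F \<mu> v)"
            using low[OF \<mu>R] up[OF \<mu>R, of x] by (simp add: t_def)
          also have "\<dots> \<le> norm (F \<mu> x)"
            using norm_triangle_ineq2[of "F \<mu> v" "F \<mu> v - F \<mu> x"] by (simp add: norm_minus_commute)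
          finally show "norm (inverse (F \<mu> x)) \<le> inverse (2 * K * t)"
            unfolding norm_inverse by (rule le_imp_inverse_le) (simp add: K(1) t)
        qed (use t C(1) in auto)
        moreover have "norm (F l x) \<le> K * t"
          using up[of l x] R zero by (simp add: F_def t_def)
        moreover have "norm (F l x) > 0" using nz[of l] t C(1) by simp
        ultimately have "2 * (K * t) \<le> K * t"
          using inverse_le_imp_le[of "norm (F l x)" "2 * K * t"] by (simp add: norm_inverse)
        then show False using K(1) t by simp
      qed
      then show ?thesis by (auto simp: F_def t_def dist_norm norm_minus_commute)
    qed
  qed (use R C in auto)
qed

text \<open>
  Any choice of the zeros just found is continuous at \<open>v\<close> by their linear distance estimate;
  this is all the implicit function theorem has to supply here.
\<close>

lemma implicit_zero_branch:
  fixes a :: "complex \<Rightarrow> complex ^ 'n" and v :: "complex ^ 'n"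
  assumes r: "0 < r" and hol: "\<And>j. (\<lambda>\<mu>. a \<mu> $ j) holomorphic_on ball l r"
    and zero: "(\<Sum>j\<in>UNIV. a l $ j * v $ j) = 0"
    and D: "((\<lambda>\<mu>. \<Sum>j\<in>UNIV. a \<mu> $ j * v $ j) has_field_derivative D) (at l)" "D \<noteq> 0"
  shows "\<exists>g. g v = l \<and> isCont g v \<and> (\<forall>\<^sub>F x in nhds v. (\<Sum>j\<in>UNIV. a (g x) $ j * x $ j) = 0)"
proof -
  obtain C d where C: "0 < C" "0 < d"
    and ex: "\<And>x. norm (x - v) < d \<Longrightarrow> \<exists>\<mu>. norm (\<mu> - l) \<le> C * norm (x - v) \<and> (\<Sum>j\<in>UNIV. a \<mu> $ j * x $ j) = 0"
    using nearby_zero[OF assms] by metis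
  from ex obtain g where g: "\<And>x. norm (x - v) < d \<Longrightarrow> norm (g x - l) \<le> C * norm (x - v)"
    "\<And>x. norm (x - v) < d \<Longrightarrow> (\<Sum>j\<in>UNIV. a (g x) $ j * x $ j) = 0"
    by metis
  have ev: "\<forall>\<^sub>F x in nhds v. norm (x - v) < d"
    unfolding eventually_nhds_metric using C(2) by (auto simp: dist_norm)
  have gv: "g v = l" using g(1)[of v] C(2) by simp
  have "((\<lambda>x. g x - l) \<longlongrightarrow> 0) (at v)"
  proof (rule Lim_null_comparison)
    show "\<forall>\<^sub>F x in at v. norm (g x - l) \<le> C * norm (x - v)"
      unfolding eventually_at_filter using ev by eventually_elim (simp add: g(1))
    show "((\<lambda>x. C * norm (x - v)) \<longlongrightarrow> 0) (at v)"
      by (auto intro!: tendsto_eq_intros)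
  qed
  then have "isCont g v" unfolding isCont_def gv by (simp add: LIM_zero_iff)
  moreover have "\<forall>\<^sub>F x in nhds v. (\<Sum>j\<in>UNIV. a (g x) $ j * x $ j) = 0"
    using ev by eventually_elim (rule g(2))
  ultimately show ?thesis using gv by blast
qed

text \<open>
  A product rule with one factor merely continuous: where the other factor vanishes, the term
  with the derivative of the continuous factor would be multiplied by zero.
\<close>

lemma has_derivative_mult_vanishing:
  fixes f k :: "'a::real_normed_vector \<Rightarrow> complex"
  assumes f: "(f has_derivative f') (at v)" "f v = 0" and k: "isCont k v"
  shows "((\<lambda>x. f x * k x) has_derivative (\<lambda>h. f' h * k v)) (at v)"
proof -
  have f1: "((\<lambda>x. f x * k v) has_derivative (\<lambda>h. f' h * k v)) (at v)"
    by (rule has_derivative_mult_left[OF f(1)])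
  have bl: "bounded_linear f'" using f(1) by (rule has_derivative_bounded_linear)
  then obtain B where B: "\<And>h. norm (f' h) \<le> norm h * B" using bounded_linear.bounded by blast
  have q0: "((\<lambda>x. norm (f x - f' (x - v)) / norm (x - v)) \<longlongrightarrow> 0) (at v)"
    using f unfolding has_derivative_iff_norm by simp
  \<comment> \<open>freezing \<open>k\<close> at \<open>v\<close> costs \<open>f x * (k x - k v) = O(\<parallel>x - v\<parallel>) o(1)\<close>\<close>
  have "((\<lambda>x. f x * (k x - k v)) has_derivative (\<lambda>h. 0)) (at v)"
    unfolding has_derivative_iff_norm
  proof (intro conjI)
    have "((\<lambda>x. (norm (f x - f' (x - v)) / norm (x - v) + B) * norm (k x - k v)) \<longlongrightarrow> (0 + B) * norm (k v - k v)) (at v)"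
      using k unfolding isCont_def by (intro tendsto_intros q0)
    then have *: "((\<lambda>x. (norm (f x - f' (x - v)) / norm (x - v) + B) * norm (k x - k v)) \<longlongrightarrow> 0) (at v)"
      by simp
    show "((\<lambda>x. norm (f x * (k x - k v) - f v * (k v - k v) - 0) / norm (x - v)) \<longlongrightarrow> 0) (at v)"
    proof (rule Lim_null_comparison[OF _ *])
      have "norm (f x * (k x - k v)) / norm (x - v)
          \<le> (norm (f x - f' (x - v)) / norm (x - v) + B) * norm (k x - k v)" if "x \<noteq> v" for x
      proof -
        have "norm (f x) \<le> norm (f x - f' (x - v)) + norm (x - v) * B"
          using norm_triangle_sub[of "f x" "f' (x - v)"] B[of "x - v"] by linarith
        then have "norm (f x) / norm (x - v) \<le> norm (f x - f' (x - v)) / norm (x - v) + B"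
          using that by (simp add: field_simps)
        from mult_right_mono[OF this, of "norm (k x - k v)"] show ?thesis
          by (simp add: norm_mult)
      qed
      then show "\<forall>\<^sub>F x in at v. norm (norm (f x * (k x - k v) - f v * (k v - k v) - 0) / norm (x - v))
          \<le> (norm (f x - f' (x - v)) / norm (x - v) + B) * norm (k x - k v)"
        by (auto simp: eventually_at_filter)
    qed
  qed simp
  from has_derivative_add[OF f1 this] show ?thesis by (simp add: algebra_simps)
qed

text \<open>
  Every branch that is continuous at \<open>v\<close> is differentiable there. With the Caratheodory
  factorization \<open>F(\<mu>, v) = q(\<mu>) (\<mu> - l)\<close>, the equation \<open>F(g(x), x) = 0\<close> reads
  \<open>g(x) - l = - F(g(x), x - v) / q(g(x))\<close>. The right-hand side is linear in \<open>x - v\<close> with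
  coefficients continuous at \<open>v\<close>, so the product rule above applies.
\<close>

lemma zero_branch_has_derivative:
  fixes a :: "complex \<Rightarrow> complex ^ 'n" and v :: "complex ^ 'n"
  assumes cont: "\<And>j. isCont (\<lambda>\<mu>. a \<mu> $ j) l"
    and zero: "(\<Sum>j\<in>UNIV. a l $ j * v $ j) = 0"
    and D: "((\<lambda>\<mu>. \<Sum>j\<in>UNIV. a \<mu> $ j * v $ j) has_field_derivative D) (at l)" "D \<noteq> 0"
    and g: "g v = l" "isCont g v" "\<forall>\<^sub>F x in nhds v. (\<Sum>j\<in>UNIV. a (g x) $ j * x $ j) = 0"
  shows "(g has_derivative (\<lambda>h. - (\<Sum>j\<in>UNIV. a l $ j * h $ j) / D)) (at v)"
proof -
  define F where "F \<mu> x = (\<Sum>j\<in>UNIV. a \<mu> $ j * x $ j)" for \<mu> and x :: "complex ^ 'n"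
  obtain q where q: "\<And>\<mu>. F \<mu> v = q \<mu> * (\<mu> - l)" "isCont q l" "q l = D"
    using D(1) zero unfolding CARAT_DERIV F_def by auto
  have contq: "isCont (\<lambda>x. q (g x)) v"
    using g(1,2) q(2) by (intro isCont_o2[OF g(2)]) simp
  have conta: "isCont (\<lambda>x. a (g x) $ j) v" for j
    using g(1,2) cont[of j] by (intro isCont_o2[OF g(2)]) simp
  define G where "G x = l + (\<Sum>j\<in>UNIV. (x - v) $ j * (- (a (g x) $ j) / q (g x)))" for x
  have contk: "isCont (\<lambda>x. - (a (g x) $ j) / q (g x)) v" for j
    using D(2) q(3) g(1) by (intro continuous_divide continuous_minus conta contq) auto
  have lin: "((\<lambda>x. (x - v) $ j) has_derivative (\<lambda>h. h $ j)) (at v)" for j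
    by (auto intro!: derivative_eq_intros bounded_linear.has_derivative[OF bounded_linear_vec_nth])
  have "(G has_derivative (\<lambda>h. 0 + (\<Sum>j\<in>UNIV. h $ j * (- (a (g v) $ j) / q (g v))))) (at v)"
    unfolding G_def
    by (intro has_derivative_add has_derivative_const has_derivative_sum
        has_derivative_mult_vanishing[OF lin _ contk]) simp
  then have dG: "(G has_derivative (\<lambda>h. - (\<Sum>j\<in>UNIV. a l $ j * h $ j) / D)) (at v)"
    by (simp add: g(1) q(3) sum_negf sum_divide_distrib mult.commute)
  have "\<forall>\<^sub>F x in nhds v. q (g x) \<noteq> 0"
    using contq D(2) q(3) g(1) tendsto_at_iff_tendsto_nhds[of "\<lambda>x. q (g x)" v]
    by (intro tendsto_imp_eventually_ne[of _ D]) (auto simp: isCont_def)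
  with g(3) have ev: "\<forall>\<^sub>F x in nhds v. G x = g x"
  proof eventually_elim
    case (elim x)
    have "0 = F (g x) v + F (g x) (x - v)"
      using elim(1) by (simp add: F_def right_diff_distrib sum_subtractf)
    then have "g x - l = - F (g x) (x - v) / q (g x)"
      using elim(2) by (simp add: q(1) field_simps add_eq_0_iff)
    also have "\<dots> = G x - l"
      by (simp add: F_def G_def sum_negf sum_divide_distrib mult.commute)
    finally show ?case by simp
  qed
  show ?thesis
  proof (rule has_derivative_transform_eventually[OF dG])
    show "\<forall>\<^sub>F x in at v. G x = g x"
      unfolding eventually_at_filter using ev by eventually_elim simp
  qed (use eventually_nhds_x_imp_x[OF ev] in simp_all)
qed

section \<open>The derivative of QN3\<close>

lemma has_derivative_vec:
  fixes f :: "'a::real_normed_vector \<Rightarrow> complex ^ 'n"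
  assumes "\<And>i. ((\<lambda>x. f x $ i) has_derivative (\<lambda>h. f' h $ i)) (at v)"
  shows "(f has_derivative f') (at v)"
proof -
  have ax: "bounded_linear (axis i :: complex \<Rightarrow> complex ^ 'n)" for i
  proof (rule bounded_linear_intro[where K = 1])
    show "norm (axis i x :: complex ^ 'n) \<le> norm x * 1" for x :: complex
    proof -
      have "(norm ((axis i x :: complex ^ 'n) $ j))\<^sup>2 = (if j = i then (norm x)\<^sup>2 else 0)" for j
        by (simp add: axis_def)
      then show ?thesis by (simp add: norm_vec_def L2_set_def)
    qed
  qed (simp_all add: axis_def vec_eq_iff)
  have exp: "(\<Sum>i\<in>UNIV. axis i (y $ i)) = y" for y :: "complex ^ 'n"
    by (simp add: vec_eq_iff axis_def)
  have "((\<lambda>x. \<Sum>i\<in>UNIV. axis i (f x $ i)) has_derivative (\<lambda>h. \<Sum>i\<in>UNIV. axis i (f' h $ i))) (at v)"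
    by (intro has_derivative_sum bounded_linear.has_derivative[OF ax] assms)
  then show ?thesis by (simp add: exp)
qed

lemma has_field_derivative_hdot_mat:
  assumes "\<And>i j. ((\<lambda>\<mu>. M \<mu> $ i $ j) has_field_derivative M' $ i $ j) (at l)"
  shows "((\<lambda>\<mu>. hdot w (M \<mu> *v x)) has_field_derivative hdot w (M' *v x)) (at l)"
  unfolding hdot_def matrix_vector_mult_def
  by (auto intro!: derivative_eq_intros assms simp: mult_ac)

text \<open>
  The row \<open>w\<^sup>H A\<close> in coordinates, without conjugation of the entries of \<open>A\<close>, so that it
  depends holomorphically on \<open>\<mu>\<close> for \<open>A = M(\<mu>)\<close>.
\<close>

lemma row_expansion:
  "hdot w (A *v x) = (\<Sum>j\<in>UNIV. (\<chi> j. \<Sum>i\<in>UNIV. cnj (w $ i) * A $ i $ j) $ j * x $ j)"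
  unfolding hdot_def matrix_vector_mult_def
  by (simp add: sum_distrib_left sum_distrib_right mult_ac, rule sum.swap)

lemma mat_analytic_onD:
  assumes "mat_analytic_on M S" "l \<in> S"
  obtains r where "0 < r" "\<And>i j. (\<lambda>\<mu>. M \<mu> $ i $ j) holomorphic_on ball l r"
proof -
  have "\<exists>e>0. (\<lambda>\<mu>. M \<mu> $ i $ j) holomorphic_on ball l e" for i j
    using assms unfolding mat_analytic_on_def analytic_on_def by blast
  then obtain e where e: "\<And>i j. e i j > 0" "\<And>i j. (\<lambda>\<mu>. M \<mu> $ i $ j) holomorphic_on ball l (e i j)"
    by metis
  define r where "r = Min (range (\<lambda>(i, j). e i j))"
  have "r > 0" unfolding r_def by (subst Min_gr_iff) (auto simp: e)
  moreover have "r \<le> e i j" for i j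
    unfolding r_def by (rule Min_le) (auto intro: range_eqI[of _ _ "(i, j)"])
  then have "(\<lambda>\<mu>. M \<mu> $ i $ j) holomorphic_on ball l r" for i j
    by (intro holomorphic_on_subset[OF e(2)[of i j]]) (simp add: subset_ball)
  ultimately show ?thesis using that by blast
qed

lemma mat_deriv_works:
  assumes "\<And>i j. (\<lambda>\<mu>. M \<mu> $ i $ j) holomorphic_on ball l r" "0 < r"
  shows "((\<lambda>\<mu>. M \<mu> $ i $ j) has_field_derivative mat_deriv M l $ i $ j) (at l)"
  unfolding mat_deriv_def using holomorphic_derivI[OF assms(1), of l] assms(2) by simp

text \<open>
  The existence of a branch turns the choice in \<open>qn3_mu\<close> into a genuine branch, and the
  differentiability result holds for whichever branch was chosen.
\<close>

lemma qn3_mu_props: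
  fixes M :: "complex \<Rightarrow> complex ^ 'n ^ 'n"
  assumes "mat_analytic_on M S" "l \<in> S" "M l *v v = 0"
    and "hdot (w_sigma M c \<sigma>) (mat_deriv M l *v v) \<noteq> 0"
  shows "qn3_mu M c \<sigma> l v v = l"
    and "(qn3_mu M c \<sigma> l v has_derivative
      (\<lambda>h. - hdot (w_sigma M c \<sigma>) (M l *v h) / hdot (w_sigma M c \<sigma>) (mat_deriv M l *v v))) (at v)"
proof -
  obtain r where r: "0 < r" "\<And>i j. (\<lambda>\<mu>. M \<mu> $ i $ j) holomorphic_on ball l r"
    using mat_analytic_onD[OF assms(1,2)] by metis
  define w where "w = w_sigma M c \<sigma>"
  define a where "a \<mu> = (\<chi> j. \<Sum>i\<in>UNIV. cnj (w $ i) * M \<mu> $ i $ j)" for \<mu>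
  have row: "hdot w (M \<mu> *v x) = (\<Sum>j\<in>UNIV. a \<mu> $ j * x $ j)" for \<mu> x
    unfolding a_def by (rule row_expansion)
  have hol: "(\<lambda>\<mu>. a \<mu> $ j) holomorphic_on ball l r" for j
    unfolding a_def vec_lambda_beta by (intro holomorphic_intros r)
  then have cont: "isCont (\<lambda>\<mu>. a \<mu> $ j) l" for j
    using r(1) by (meson centre_in_ball continuous_on_eq_continuous_at holomorphic_on_imp_continuous_on open_ball)
  have zero: "(\<Sum>j\<in>UNIV. a l $ j * v $ j) = 0"
    unfolding row[symmetric] assms(3) by simp
  have D: "((\<lambda>\<mu>. \<Sum>j\<in>UNIV. a \<mu> $ j * v $ j) has_field_derivative hdot w (mat_deriv M l *v v)) (at l)"
    unfolding row[symmetric]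
    by (rule has_field_derivative_hdot_mat[OF mat_deriv_works[OF r(2,1)]])
  have nz: "hdot w (mat_deriv M l *v v) \<noteq> 0" using assms(4) by (simp add: w_def)
  have "\<exists>\<mu>. \<mu> v = l \<and> isCont \<mu> v \<and> (\<forall>\<^sub>F x in nhds v. hdot w (M (\<mu> x) *v x) = 0)"
    unfolding row by (rule implicit_zero_branch[OF r(1) hol zero D nz])
  from someI_ex[OF this]
  have mu: "qn3_mu M c \<sigma> l v v = l" "isCont (qn3_mu M c \<sigma> l v) v"
    "\<forall>\<^sub>F x in nhds v. (\<Sum>j\<in>UNIV. a (qn3_mu M c \<sigma> l v x) $ j * x $ j) = 0"
    unfolding row[symmetric] qn3_mu_def w_def by blast+
  show "qn3_mu M c \<sigma> l v v = l" by (rule mu)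
  show "(qn3_mu M c \<sigma> l v has_derivative
      (\<lambda>h. - hdot (w_sigma M c \<sigma>) (M l *v h) / hdot (w_sigma M c \<sigma>) (mat_deriv M l *v v))) (at v)"
    using zero_branch_has_derivative[OF cont zero D nz mu]
    unfolding row[symmetric] w_def[symmetric] .
qed

text \<open>
  With \<open>\<mu>'(h) = - w\<^sup>H M(l) h / (w\<^sup>H p)\<close>, the unnormalized step \<open>y(x) = x - N M(\<mu>(x)) x\<close> has the
  derivative \<open>h - N (\<mu>'(h) p + M(l) h) = N B h\<close> at \<open>v\<close>, the identity \<open>h = N M(\<sigma>) h\<close> bringing in
  \<open>M(\<sigma>)\<close>. Normalization by \<open>c\<^sup>H y\<close> has the derivative \<open>P\<close> at \<open>y(v) = v\<close>, since \<open>c\<^sup>H v = 1\<close>.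
\<close>

lemma qn3_matrix_eq:
  fixes M :: "complex \<Rightarrow> complex ^ 'n ^ 'n"
  assumes "mat_analytic_on M S" "l \<in> S" "M l *v v = 0" "hdot c v = 1"
    and inv: "matrix_inv (M \<sigma>) ** M \<sigma> = mat 1"
    and nz: "hdot (w_sigma M c \<sigma>) (mat_deriv M l *v v) \<noteq> 0"
  shows "qn3_matrix M c \<sigma> l v = (mat 1 - houter v c) ** matrix_inv (M \<sigma>) **
    (M \<sigma> - M l + houter ((1 / hdot (w_sigma M c \<sigma>) (mat_deriv M l *v v)) *s (mat_deriv M l *v v))
       (w_sigma M c \<sigma>) ** M l)"
proof -
  obtain r where r: "0 < r" "\<And>i j. (\<lambda>\<mu>. M \<mu> $ i $ j) holomorphic_on ball l r"
    using mat_analytic_onD[OF assms(1,2)] by metis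
  define w where "w = w_sigma M c \<sigma>"
  define N where "N = matrix_inv (M \<sigma>)"
  define \<mu> where "\<mu> = qn3_mu M c \<sigma> l v"
  define p where "p = mat_deriv M l *v v"
  define B where "B = M \<sigma> - M l + houter ((1 / hdot w p) *s p) w ** M l"
  define y where "y x = x - N *v (M (\<mu> x) *v x)" for x
  define \<mu>' where "\<mu>' h = - hdot w (M l *v h) / hdot w p" for h
  have \<mu>v: "\<mu> v = l" and d\<mu>: "(\<mu> has_derivative \<mu>') (at v)"
    using qn3_mu_props[OF assms(1-3) nz] unfolding \<mu>_def \<mu>'_def w_def p_def by auto
  have nth: "((\<lambda>x. x $ i) has_derivative (\<lambda>h. h $ i)) (at v)" for i and v :: "complex ^ 'n"
    by (rule bounded_linear.has_derivative[OF bounded_linear_vec_nth has_derivative_ident])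
  have dM: "((\<lambda>x. M (\<mu> x) $ i $ j) has_derivative (\<lambda>h. mat_deriv M l $ i $ j * \<mu>' h)) (at v)" for i j
    using has_derivative_compose[OF d\<mu>, of "\<lambda>\<mu>. M \<mu> $ i $ j" "\<lambda>h. mat_deriv M l $ i $ j * h"]
      mat_deriv_works[OF r(2,1), of i j] by (simp add: \<mu>v has_field_derivative_def)
  have dMx: "((\<lambda>x. M (\<mu> x) *v x) has_derivative (\<lambda>h. \<mu>' h *s p + M l *v h)) (at v)"
  proof (rule has_derivative_vec)
    fix i
    have "((\<lambda>x. \<Sum>j\<in>UNIV. M (\<mu> x) $ i $ j * x $ j) has_derivative
        (\<lambda>h. \<Sum>j\<in>UNIV. M (\<mu> v) $ i $ j * h $ j + mat_deriv M l $ i $ j * \<mu>' h * v $ j)) (at v)"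
      by (intro has_derivative_sum has_derivative_mult dM nth)
    then show "((\<lambda>x. (M (\<mu> x) *v x) $ i) has_derivative (\<lambda>h. (\<mu>' h *s p + M l *v h) $ i)) (at v)"
      by (simp add: matrix_vector_mult_def \<mu>v p_def sum.distrib sum_distrib_left mult_ac add_ac)
  qed
  have NB: "(N ** B) *v h = h - N *v (\<mu>' h *s p + M l *v h)" for h
  proof -
    have "B *v h = M \<sigma> *v h - (\<mu>' h *s p + M l *v h)"
      by (simp add: B_def matrix_vector_mult_add_rdistrib matrix_vector_mult_diff_rdistrib
          matrix_vector_mul_assoc[symmetric] houter_mult_vec \<mu>'_def)
    moreover have "N *v (M \<sigma> *v h) = h"
      unfolding matrix_vector_mul_assoc N_def inv by simp
    ultimately show ?thesis
      by (simp add: matrix_vector_mul_assoc[symmetric] matrix_vector_mult_diff_distrib)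
  qed
  have dy: "(y has_derivative (\<lambda>h. (N ** B) *v h)) (at v)"
    unfolding y_def NB
    by (intro has_derivative_diff has_derivative_ident
        bounded_linear.has_derivative[OF matrix_vector_mul_bounded_linear] dMx)
  have yv: "y v = v" by (simp add: y_def \<mu>v assms(3))
  have dyi: "((\<lambda>x. y x $ i) has_derivative (\<lambda>h. ((N ** B) *v h) $ i)) (at v)" for i
    by (rule bounded_linear.has_derivative[OF bounded_linear_vec_nth dy])
  have dc: "((\<lambda>x. hdot c (y x)) has_derivative (\<lambda>h. hdot c ((N ** B) *v h))) (at v)"
    unfolding hdot_def by (intro has_derivative_sum has_derivative_mult_right dyi)
  have ds: "(qn3_step M c \<sigma> l v has_derivative (\<lambda>h. ((mat 1 - houter v c) ** N ** B) *v h)) (at v)"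
  proof (rule has_derivative_vec)
    fix i
    have "((\<lambda>x. y x $ i / hdot c (y x)) has_derivative
        (\<lambda>h. ((N ** B) *v h) $ i - v $ i * hdot c ((N ** B) *v h))) (at v)"
      using has_derivative_divide'[OF dyi dc] by (simp add: yv assms(4))
    moreover have "qn3_step M c \<sigma> l v x $ i = y x $ i / hdot c (y x)" for x
      by (simp add: qn3_step_def Let_def y_def N_def \<mu>_def diff_divide_distrib)
    moreover have "(((mat 1 - houter v c) ** N ** B) *v h) $ i
        = ((N ** B) *v h) $ i - v $ i * hdot c ((N ** B) *v h)" for h
      by (simp add: matrix_mul_assoc[symmetric] matrix_vector_mul_assoc[symmetric]
          matrix_vector_mult_diff_rdistrib houter_mult_vec)
    ultimately show "((\<lambda>x. qn3_step M c \<sigma> l v x $ i) has_derivative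
        (\<lambda>h. (((mat 1 - houter v c) ** N ** B) *v h) $ i)) (at v)" by simp
  qed
  have "qn3_matrix M c \<sigma> l v = (mat 1 - houter v c) ** N ** B"
    unfolding qn3_matrix_def
  proof (rule the_equality[where P = "\<lambda>A. (qn3_step M c \<sigma> l v has_derivative (\<lambda>h. A *v h)) (at v)"])
    fix A assume "(qn3_step M c \<sigma> l v has_derivative (\<lambda>h. A *v h)) (at v)"
    from has_derivative_unique[OF this ds] show "A = (mat 1 - houter v c) ** N ** B"
      unfolding matrix_eq by meson
  qed (rule ds)
  then show ?thesis unfolding N_def B_def w_def p_def .
qed

section \<open>Comparison of QN2 and QN3\<close>

text \<open>
  Since \<open>w\<^sup>H = c\<^sup>H N\<close>, the number \<open>\<alpha> = (w\<^sup>H p)\<^sup>-\<^sup>1\<close> normalizes \<open>N p\<close> to \<open>c\<^sup>H (\<alpha> N p) = 1\<close>, just as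
  \<open>c\<^sup>H v = 1\<close>; this is why \<open>I - \<alpha> N p c\<^sup>H\<close> and \<open>I - v c\<^sup>H\<close> are both annihilated by \<open>c\<^sup>H\<close>. The
  second claim provides the eigenvalue \<open>0\<close> needed to compare spectral radius and norm.
\<close>

lemma spectral_radius_qn2_eq_qn3:
  fixes M :: "complex \<Rightarrow> complex ^ 'n ^ 'n"
  assumes "mat_analytic_on M S" "l \<in> S" "M l *v v = 0" "hdot c v = 1"
    and inv: "matrix_inv (M \<sigma>) ** M \<sigma> = mat 1"
    and nz: "hdot (w_sigma M c \<sigma>) (mat_deriv M l *v v) \<noteq> 0"
  shows "spectral_radius (qn2_matrix M c \<sigma> l v) = spectral_radius (qn3_matrix M c \<sigma> l v)"
    and "det (qn3_matrix M c \<sigma> l v) = 0"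
proof -
  define N where "N = matrix_inv (M \<sigma>)"
  define p where "p = mat_deriv M l *v v"
  define \<alpha> where "\<alpha> = inverse (hdot c (N *v p))"
  have w: "hdot (w_sigma M c \<sigma>) x = hdot c (N *v x)" for x
    by (simp add: w_sigma_def hdot_hconj N_def)
  have \<alpha>: "\<alpha> * hdot c (N *v p) = 1"
    using nz unfolding w by (simp add: \<alpha>_def p_def)
  have NM: "N *v (M \<sigma> *v x) = x" for x
    unfolding matrix_vector_mul_assoc N_def inv by simp
  let ?A11 = "(mat 1 - houter (\<alpha> *s (N *v p)) c) ** N ** (M \<sigma> - M l)"
  let ?A3 = "qn3_matrix M c \<sigma> l v"
  have A11: "?A11 *v x = x - N *v (M l *v x) - (\<alpha> * hdot c (x - N *v (M l *v x))) *s (N *v p)" for x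
    by (simp add: matrix_vector_mul_assoc[symmetric] matrix_vector_mult_diff_rdistrib
        houter_mult_vec matrix_vector_mult_diff_distrib NM)
       (simp add: vec_eq_iff algebra_simps)
  have A3: "?A3 *v x = y - hdot c y *s v"
    if "y = x - N *v (M l *v x) + (\<alpha> * hdot c (N *v (M l *v x))) *s (N *v p)" for x y
    unfolding qn3_matrix_eq[OF assms] w that
    by (simp add: matrix_vector_mul_assoc[symmetric] matrix_vector_mult_diff_rdistrib
        matrix_vector_mult_add_rdistrib matrix_vector_right_distrib vector_scalar_commute
        houter_mult_vec matrix_vector_mult_diff_distrib NM w N_def[symmetric] p_def[symmetric]
        \<alpha>_def inverse_eq_divide mult_ac)
  have c0: "c \<noteq> 0" using assms(4) by (auto simp: hdot_def)
  have cA11: "hdot c (?A11 *v x) = 0" for x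
    unfolding A11 using arg_cong[OF \<alpha>, of "\<lambda>s. s * hdot c (x - N *v (M l *v x))"]
    by (simp add: algebra_simps)
  have cA3: "hdot c (?A3 *v x) = 0" for x
    unfolding A3[OF refl] by (simp add: assms(4))
  have eq: "?A11 *v x = ?A3 *v x" if "hdot c x = 0" for x
  proof -
    define y where "y = x - N *v (M l *v x) + (\<alpha> * hdot c (N *v (M l *v x))) *s (N *v p)"
    have "hdot c y = 0" using that \<alpha> by (simp add: y_def algebra_simps)
    then show ?thesis unfolding A3[OF y_def] A11
      using that by (simp add: y_def vec_eq_iff)
  qed
  show "det ?A3 = 0" using det_zero_iff_left_kernel c0 cA3 by blast
  have sing: "det ?A11 = 0" using det_zero_iff_left_kernel c0 cA11 by blast
  show "spectral_radius (qn2_matrix M c \<sigma> l v) = spectral_radius ?A3"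
    unfolding spectral_radius_def qn2_matrix_def Let_def w
      N_def[symmetric] p_def[symmetric] \<alpha>_def[symmetric]
      block_column_eigenvalues[OF sing]
    by (simp only: eigenvalues_eq_of_annihilated[OF c0 cA11 cA3 eq])
qed

section \<open>The bound from the Keldysh expansion\<close>

text \<open>
  The expansion of \<open>M(\<sigma>)\<^sup>-\<^sup>1\<close> holds at \<open>\<sigma>\<close> by the definition of the remainder, and \<open>I - v\<^sub>1 c\<^sup>H\<close>
  removes the rank-one term with range spanned by \<open>v\<^sub>1\<close>. Each other rank-one term
  \<open>v\<^sub>i u\<^sub>i\<^sup>H / ((\<sigma> - \<lambda>\<^sub>i) u\<^sub>i\<^sup>H M'(\<lambda>\<^sub>i) v\<^sub>i)\<close> has norm at most \<open>\<kappa>\<^sub>i / |\<sigma> - \<lambda>\<^sub>i|\<close>.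
\<close>

lemma projected_inverse_norm_le:
  fixes M :: "complex \<Rightarrow> complex ^ 'n ^ 'n"
  assumes "k \<ge> 1" "\<sigma> \<notin> lam ` {1..k}" "hdot c (v 1) = 1"
  shows "spectral_norm ((mat 1 - houter (v 1) c) ** matrix_inv (M \<sigma>))
    \<le> spectral_norm (mat 1 - houter (v 1) c)
      * ((\<Sum>i=2..k. 1 / norm (\<sigma> - lam i) * eig_cond M (lam i) (v i) (u i))
         + spectral_norm (keldysh_remainder M k lam v u \<sigma>))"
proof -
  let ?P = "mat 1 - houter (v 1) c" and ?R = "keldysh_remainder M k lam v u \<sigma>"
  define a where "a i = 1 / (\<sigma> - lam i) * (1 / hdot (u i) (mat_deriv M (lam i) *v v i))" for i
  define H where "H i = houter (a i *s v i) (u i)" for i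
  have "matrix_inv (M \<sigma>) = (\<Sum>i=1..k. H i) + ?R"
    using assms(2) by (simp add: keldysh_remainder_def H_def a_def)
  also have "\<dots> = H 1 + ((\<Sum>i=2..k. H i) + ?R)"
    using assms(1) by (simp add: sum.atLeast_Suc_atMost numeral_2_eq_2 add.assoc)
  finally have N: "matrix_inv (M \<sigma>) = H 1 + ((\<Sum>i=2..k. H i) + ?R)" .
  have "?P ** H 1 = 0"
    unfolding matrix_eq H_def
    by (simp add: matrix_vector_mul_assoc[symmetric] houter_mult_vec
        matrix_vector_mult_diff_rdistrib assms(3)[unfolded One_nat_def])
  then have PN: "?P ** matrix_inv (M \<sigma>) = ?P ** ((\<Sum>i=2..k. H i) + ?R)"
    unfolding N matrix_add_ldistrib[of ?P "H 1"] by simp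
  have "spectral_norm (H i) \<le> 1 / norm (\<sigma> - lam i) * eig_cond M (lam i) (v i) (u i)" for i
    using spectral_norm_houter[of "a i *s v i" "u i"]
    by (simp add: H_def a_def eig_cond_def norm_scale_vec norm_divide norm_mult mult_ac)
  then have "spectral_norm ((\<Sum>i=2..k. H i) + ?R)
      \<le> (\<Sum>i=2..k. 1 / norm (\<sigma> - lam i) * eig_cond M (lam i) (v i) (u i)) + spectral_norm ?R"
    by (intro order_trans[OF spectral_norm_add] add_right_mono
        order_trans[OF spectral_norm_sum] sum_mono)
  from mult_left_mono[OF this spectral_norm_nonneg[of ?P]]
  show ?thesis unfolding PN by (rule order_trans[OF spectral_norm_mult])
qed

theorem corollary4p2:
  fixes M :: "complex \<Rightarrow> complex ^ 'n ^ 'n"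
    and c :: "complex ^ 'n"
    and \<Omega> :: "complex set"
    and \<gamma> :: "real \<Rightarrow> complex"
    and k :: nat
    and lam :: "nat \<Rightarrow> complex"
    and v u :: "nat \<Rightarrow> complex ^ 'n"
    and \<sigma> :: complex
  assumes "closed_domain \<Omega>" and "simply_connected \<Omega>"
    and "simple_path \<gamma>" and "pathfinish \<gamma> = pathstart \<gamma>" and "valid_path \<gamma>"
    and "frontier \<Omega> = path_image \<gamma>"
    and "mat_analytic_on M \<Omega>"
    and "k \<ge> 1" and "inj_on lam {1..k}"
    and "{l \<in> \<Omega>. nep_eigenvalue M l} = lam ` {1..k}"
    and "\<And>i. i \<in> {1..k} \<Longrightarrow> lam i \<in> inside (path_image \<gamma>)"
    and "\<And>i. i \<in> {1..k} \<Longrightarrow> simple_eigenvalue M (lam i)"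
    and "\<And>i. i \<in> {1..k} \<Longrightarrow> eigentriplet M (lam i) (v i) (u i)"
    and "\<And>i. i \<in> {1..k} \<Longrightarrow> hdot c (v i) = 1"
    and "\<sigma> \<in> \<Omega> - lam ` {1..k}"
    and "hdot (w_sigma M c \<sigma>) (mat_deriv M (lam 1) *v v 1) \<noteq> 0"
  shows "spectral_radius (qn2_matrix M c \<sigma> (lam 1) (v 1))
           = spectral_radius (qn3_matrix M c \<sigma> (lam 1) (v 1)) \<and>
         spectral_radius (qn3_matrix M c \<sigma> (lam 1) (v 1))
           \<le> spectral_norm (mat 1 - houter (v 1) c)
             * spectral_norm (M \<sigma> - M (lam 1)
                 + houter ((1 / hdot (w_sigma M c \<sigma>) (mat_deriv M (lam 1) *v v 1))
                             *s (mat_deriv M (lam 1) *v v 1)) (w_sigma M c \<sigma>) ** M (lam 1))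
             * ((\<Sum>i=2..k. 1 / norm (\<sigma> - lam i) * eig_cond M (lam i) (v i) (u i))
                + spectral_norm (keldysh_remainder M k lam v u \<sigma>))"
    (is "?rho2 = ?rho3 \<and> ?rho3 \<le> ?p * spectral_norm ?B * ?K")
proof -
  have one: "1 \<in> {1..k}" using assms(8) by simp
  have l: "lam 1 \<in> \<Omega>" using assms(10) one by blast
  have Mv: "M (lam 1) *v v 1 = 0" using assms(13)[OF one] by (simp add: eigentriplet_def)
  have cv: "hdot c (v 1) = 1" by (rule assms(14)[OF one])
  have "\<not> nep_eigenvalue M \<sigma>" using assms(10,15) by blast
  then have inv: "matrix_inv (M \<sigma>) ** M \<sigma> = mat 1" by (rule matrix_inv_left_off_eigenvalues)
  note hyps = assms(7) l Mv cv inv assms(16)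
  have "?rho3 \<le> spectral_norm (qn3_matrix M c \<sigma> (lam 1) (v 1))"
    by (rule spectral_radius_le[OF spectral_radius_qn2_eq_qn3(2)[OF hyps]])
  also have "\<dots> \<le> spectral_norm ((mat 1 - houter (v 1) c) ** matrix_inv (M \<sigma>)) * spectral_norm ?B"
    unfolding qn3_matrix_eq[OF hyps] by (rule spectral_norm_mult)
  also have "\<dots> \<le> (?p * ?K) * spectral_norm ?B"
    using assms(8,15) cv by (intro mult_right_mono projected_inverse_norm_le spectral_norm_nonneg) auto
  finally show ?thesis
    using spectral_radius_qn2_eq_qn3(1)[OF hyps] by (simp add: mult_ac)
qed

end
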